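(* For any rendezvous algorithm $A$, for any $D>0$, and for any integers $k_2\ge k_1>0$, there exist two labels $l_1$ and $l_2$ of lengths at most $k_1$ and at most $k_2$, respectively, and a polygon with a single obstacle of perimeter $2D$, such that algorithm $A$ executed by agents with labels $l_1$ and $l_2$ starting at distance $D$ requires cost $\Omega(Dk_1)$. This holds even if the two agents have a map.
   Context: A terrain is a planar set $\mathcal{P}_0\setminus(\mathcal{P}_1\cup\dots\cup\mathcal{P}_k)$, where $\mathcal{P}_0$ is a closed polygon and $\mathcal{P}_1,\dots,\mathcal{P}_k$ (the obstacles, possibly none) are disjoint open polygons included in $\mathcal{P}_0$; the boundary of the terrain belongs to it. The distance between two points of the terrain is the length of a shortest path between them included in the terrain. The scenario is that of terrains with obstacles and possibly incoherent compasses. Agents: two agents, modeled as points, start at different points of the terrain chosen by the adversary. Each has a unit of length and a compass (a direction called North); both use the same clockwise orientation. The compasses may be incoherent, i.e., the agents may have different Norths. An agent knows whether it is at an interior or a boundary point, and in the latter case the slope(s) of the boundary there; it cannot sense the terrain or the other agent in any vicinity of its location. A map available to an agent shows the terrain to scale, marks the starting positions of this agent and of the other agent, and is oriented according to the agent's own compass. In this scenario agents are equipped with distinct labels, which are positive integers; each agent uses its own label as a parameter of the algorithm. The length of a label $\mu$ is $|\mu|=\lfloor\log_2\mu\rfloor+1$, the length of its binary representation. Routes: a deterministic algorithm makes an agent construct a finite polygonal path in the terrain (its route) in steps. In a step starting at a point, the agent chooses a direction (according to its compass) and a distance; if the segment of this length in this direction does not intersect the boundary, the step ends at the end of this segment,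 otherwise it ends at the closest boundary point in this direction. If the starting point of the step is on a segment of the boundary, the agent may alternatively follow this segment in either direction until its end or for a given distance. Walks: let the route be $(S_1,\dots,S_k)$ with $S_i=[a_i,a_{i+1}]$. The adversary chooses reals $0=t_1<t_2<\dots<t_{k+1}$ and continuous functions $f_i:[t_i,t_{i+1}]\to[a_i,a_{i+1}]$ with $f_i(t_i)=a_i$, $f_i(t_{i+1})=a_{i+1}$; the walk is $f(t)=f_i(t)$ for $t\in[t_i,t_{i+1}]$, and the agent is inert after $t_{k+1}$. Agents with walks $f_1,f_2$ meet (rendezvous) at time $t$ if $f_1(t)=f_2(t)$. A rendezvous algorithm is a deterministic algorithm guaranteeing that the agents meet regardless of the walks chosen by the adversary. The trajectory of an agent is the sequence of segments of its route until rendezvous (the last one possibly being a portion of a route segment). The cost is the worst-case (over adversarial decisions) sum of the lengths of the segments of the trajectories of both agents.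
   Formalization: The formal statement assumes k_2 ≥ 2, because for k_1 = k_2 = 1 the only label of length at most 1 is the label 1, so two distinct labels do not exist. *)

theory Defs
  imports "HOL-Analysis.Analysis"
begin

text \<open>The plane is \<^typ>\<open>complex\<close>. All lengths are expressed in the agents' unit of length.\<close>

section \<open>Polygons and terrains\<close>

fun polygonal_path :: "complex list \<Rightarrow> real \<Rightarrow> complex" where
  "polygonal_path [] = linepath 0 0"
| "polygonal_path [a] = linepath a a"
| "polygonal_path [a, b] = linepath a b"
| "polygonal_path (a # b # c # vs) = linepath a b +++ polygonal_path (b # c # vs)"

text \<open>A polygon is given by the cyclic list of its vertices (without repeating the first one).\<close>

definition polygon_boundary_path :: "complex list \<Rightarrow> real \<Rightarrow> complex" where
  "polygon_boundary_path vs = polygonal_path (vs @ [hd vs])"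

definition is_polygon :: "complex list \<Rightarrow> bool" where
  "is_polygon vs \<longleftrightarrow> 3 \<le> length vs \<and> simple_path (polygon_boundary_path vs)"

definition open_polygon :: "complex list \<Rightarrow> complex set" where
  "open_polygon vs = inside (path_image (polygon_boundary_path vs))"

definition closed_polygon :: "complex list \<Rightarrow> complex set" where
  "closed_polygon vs = path_image (polygon_boundary_path vs) \<union> open_polygon vs"

definition perimeter :: "complex list \<Rightarrow> real" where
  "perimeter vs = (\<Sum>i<length vs. dist (vs ! i) (vs ! (Suc i mod length vs)))"

definition valid_terrain :: "complex list \<Rightarrow> complex list set \<Rightarrow> bool" where
  "valid_terrain P Obs \<longleftrightarrow>
     is_polygon P \<and> finite Obs \<and>
     (\<forall>Q\<in>Obs. is_polygon Q \<and> open_polygon Q \<subseteq> closed_polygon P) \<and>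
     pairwise (\<lambda>Q R. disjnt (open_polygon Q) (open_polygon R)) Obs"

definition terrain_set :: "complex list \<Rightarrow> complex list set \<Rightarrow> complex set" where
  "terrain_set P Obs = closed_polygon P - (\<Union>Q\<in>Obs. open_polygon Q)"

definition is_terrain :: "complex set \<Rightarrow> bool" where
  "is_terrain T \<longleftrightarrow> (\<exists>P Obs. valid_terrain P Obs \<and> T = terrain_set P Obs)"

definition curve_length :: "(real \<Rightarrow> complex) \<Rightarrow> ereal" where
  "curve_length g =
     (SUP xs \<in> {xs. sorted xs \<and> set xs \<subseteq> {0..1}}.
        ereal (\<Sum>i<length xs - 1. dist (g (xs ! i)) (g (xs ! Suc i))))"

definition terrain_dist :: "complex set \<Rightarrow> complex \<Rightarrow> complex \<Rightarrow> ereal" where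
  "terrain_dist T a b =
     (INF g \<in> {g. path g \<and> path_image g \<subseteq> T \<and> pathstart g = a \<and> pathfinish g = b}.
        curve_length g)"


section \<open>Steps and routes\<close>

text \<open>
  Directions are angles measured clockwise from the agent's North, which is a unit complex
  number \<open>n\<close>. The argument of \<open>Go\<close> and \<open>Follow\<close> is an angle followed by a distance;
  \<open>Follow \<theta> None\<close> follows a boundary segment until its end. Negative distances count as \<open>0\<close>.
\<close>

datatype action = Go real real | Follow real "real option"

text \<open>
  The distances that can be travelled from \<open>p\<close> in direction \<open>u\<close> within \<open>S\<close>. The starting point is
  exempt, so that a step may leave the boundary; since \<open>S\<close> will be the interior or
  the boundary of the terrain, the endpoint need not lie in \<open>S\<close> but lies in the terrain.
\<close>

definition free_run :: "complex set \<Rightarrow> complex \<Rightarrow> complex \<Rightarrow> real set" where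
  "free_run S p u = {s. 0 \<le> s \<and> (\<forall>r. 0 < r \<and> r < s \<longrightarrow> p + of_real r * u \<in> S)}"

definition advance :: "complex set \<Rightarrow> complex \<Rightarrow> complex \<Rightarrow> real option \<Rightarrow> complex" where
  "advance S p u d =
     p + of_real (Sup (free_run S p u \<inter> (case d of None \<Rightarrow> UNIV | Some l \<Rightarrow> {..max 0 l}))) * u"

text \<open>
  A step that points out of the terrain, or that follows the boundary in a direction in which it
  does not extend, has length \<open>0\<close>.
\<close>

fun step :: "complex set \<Rightarrow> complex \<Rightarrow> complex \<Rightarrow> action \<Rightarrow> complex" where
  "step T n p (Go \<theta> d) = advance (interior T) p (n * cis (- \<theta>)) (Some d)"
| "step T n p (Follow \<theta> d) = advance (frontier T) p (n * cis (- \<theta>)) d"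

text \<open>
  Private coordinates of an agent: its start is the origin and its North is the direction \<open>1\<close>.
  Only rotations and translations occur, as both agents agree on the clockwise orientation.
\<close>

definition chart :: "complex \<Rightarrow> complex \<Rightarrow> complex \<Rightarrow> complex" where
  "chart x n p = (p - x) / n"

text \<open>
  A slope is an unoriented direction, represented by both of its unit vectors. There may be
  several of them, for instance at a vertex.
\<close>

datatype percept = Interior | Boundary "complex set"

definition slopes :: "complex set \<Rightarrow> complex \<Rightarrow> complex set" where
  "slopes S p = {u. norm u = 1 \<and> (\<exists>e>0. closed_segment p (p + of_real e * u) \<subseteq> S \<or>
                                          closed_segment p (p - of_real e * u) \<subseteq> S)}"

definition observe :: "complex set \<Rightarrow> complex \<Rightarrow> complex \<Rightarrow> complex \<Rightarrow> complex \<times> percept" where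
  "observe T x n p =
     (chart x n p,
      if p \<in> frontier T then Boundary ((\<lambda>u. u / n) ` slopes (frontier T) p) else Interior)"

text \<open>
  From the agent's label, its map (if any) and what it has observed at its start and
  after each step, the algorithm determines the next step, or \<open>None\<close> to end the route.
  The map consists of the terrain and the start of the other agent, in private coordinates.
\<close>

type_synonym terrain_map = "complex set \<times> complex"
type_synonym algorithm =
  "nat \<Rightarrow> terrain_map option \<Rightarrow> (complex \<times> percept) list \<Rightarrow> action option"

text \<open>The flag \<open>m\<close> tells whether the agents have a map.\<close>

definition agent_map ::
  "bool \<Rightarrow> complex set \<Rightarrow> complex \<Rightarrow> complex \<Rightarrow> complex \<Rightarrow> terrain_map option" where
  "agent_map m T x n y = (if m then Some (chart x n ` T, chart x n y) else None)"

definition decision ::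
  "bool \<Rightarrow> algorithm \<Rightarrow> nat \<Rightarrow> complex set \<Rightarrow> complex \<Rightarrow> complex \<Rightarrow> complex \<Rightarrow>
   complex list \<Rightarrow> action option" where
  "decision m A \<mu> T x n y ps = A \<mu> (agent_map m T x n y) (map (observe T x n) ps)"

text \<open>
  \<open>x\<close> is the start of the agent, \<open>n\<close> its North and \<open>y\<close> the start of the other agent (used
  for the map only). A route is given by the list of its points \<open>[a\<^sub>1, \<dots>, a\<^sub>k\<^sub>+\<^sub>1]\<close>.
\<close>

primrec trace ::
  "bool \<Rightarrow> algorithm \<Rightarrow> nat \<Rightarrow> complex set \<Rightarrow> complex \<Rightarrow> complex \<Rightarrow> complex \<Rightarrow> nat \<Rightarrow> complex list"
where
  "trace m A \<mu> T x n y 0 = [x]"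
| "trace m A \<mu> T x n y (Suc k) =
     (let ps = trace m A \<mu> T x n y k in
      case decision m A \<mu> T x n y ps of
        None \<Rightarrow> ps
      | Some act \<Rightarrow> ps @ [step T n (last ps) act])"

definition is_route ::
  "bool \<Rightarrow> algorithm \<Rightarrow> nat \<Rightarrow> complex set \<Rightarrow> complex \<Rightarrow> complex \<Rightarrow> complex \<Rightarrow> complex list \<Rightarrow> bool"
where
  "is_route m A \<mu> T x n y ps \<longleftrightarrow>
     (\<exists>k. ps = trace m A \<mu> T x n y k) \<and> decision m A \<mu> T x n y ps = None"


section \<open>Walks, rendezvous and cost\<close>

text \<open>\<open>\<tau>\<close> gives the times at which the points of the route are reached; only times \<open>\<ge> 0\<close> matter.\<close>

definition is_walk :: "complex list \<Rightarrow> (nat \<Rightarrow> real) \<Rightarrow> (real \<Rightarrow> complex) \<Rightarrow> bool" where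
  "is_walk ps \<tau> f \<longleftrightarrow>
     \<tau> 0 = 0 \<and>
     (\<forall>i. Suc i < length ps \<longrightarrow>
        \<tau> i < \<tau> (Suc i) \<and>
        continuous_on {\<tau> i..\<tau> (Suc i)} f \<and>
        f ` {\<tau> i..\<tau> (Suc i)} \<subseteq> closed_segment (ps ! i) (ps ! Suc i) \<and>
        f (\<tau> i) = ps ! i \<and> f (\<tau> (Suc i)) = ps ! Suc i) \<and>
     (\<forall>t\<ge>\<tau> (length ps - 1). f t = last ps)"

definition rendezvous_algorithm :: "bool \<Rightarrow> algorithm \<Rightarrow> bool" where
  "rendezvous_algorithm m A \<longleftrightarrow>
     (\<forall>T a b n1 n2 \<mu>1 \<mu>2.
        is_terrain T \<and> a \<in> T \<and> b \<in> T \<and> a \<noteq> b \<and> norm n1 = 1 \<and> norm n2 = 1 \<and>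
        0 < \<mu>1 \<and> 0 < \<mu>2 \<and> \<mu>1 \<noteq> \<mu>2 \<longrightarrow>
        (\<exists>ps qs. is_route m A \<mu>1 T a n1 b ps \<and> is_route m A \<mu>2 T b n2 a qs \<and>
           (\<forall>\<tau> f \<sigma> g. is_walk ps \<tau> f \<and> is_walk qs \<sigma> g \<longrightarrow> (\<exists>t\<ge>0. f t = g t))))"

definition rendezvous_time :: "(real \<Rightarrow> complex) \<Rightarrow> (real \<Rightarrow> complex) \<Rightarrow> real \<Rightarrow> bool" where
  "rendezvous_time f g t \<longleftrightarrow>
     0 \<le> t \<and> f t = g t \<and> (\<forall>s. 0 \<le> s \<and> s < t \<longrightarrow> f s \<noteq> g s)"

text \<open>
  The length of the trajectory up to time \<open>t\<close>: the segments completed by then, and the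
  portion of the current segment from its starting point to the current position.
\<close>

definition trajectory_length ::
  "complex list \<Rightarrow> (nat \<Rightarrow> real) \<Rightarrow> (real \<Rightarrow> complex) \<Rightarrow> real \<Rightarrow> real" where
  "trajectory_length ps \<tau> f t =
     (\<Sum>i<length ps - 1.
        if \<tau> (Suc i) \<le> t then dist (ps ! i) (ps ! Suc i)
        else if \<tau> i \<le> t then dist (ps ! i) (f t)
        else 0)"

text \<open>
  The worst case over both Norths and both walks, for agents with labels \<open>\<mu>1\<close> and \<open>\<mu>2\<close>
  starting at \<open>a\<close> and \<open>b\<close> in \<open>T\<close>.
\<close>

definition rendezvous_cost ::
  "bool \<Rightarrow> algorithm \<Rightarrow> nat \<Rightarrow> nat \<Rightarrow> complex set \<Rightarrow> complex \<Rightarrow> complex \<Rightarrow> ereal" where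
  "rendezvous_cost m A \<mu>1 \<mu>2 T a b =
     Sup {ereal (trajectory_length ps \<tau> f t + trajectory_length qs \<sigma> g t) |n1 n2 ps \<tau> f qs \<sigma> g t.
            norm n1 = 1 \<and> norm n2 = 1 \<and>
            is_route m A \<mu>1 T a n1 b ps \<and> is_route m A \<mu>2 T b n2 a qs \<and>
            is_walk ps \<tau> f \<and> is_walk qs \<sigma> g \<and> rendezvous_time f g t}"

text \<open>
  Labels are positive. The only label of length at most \<open>1\<close> is \<open>1\<close>, so two distinct labels
  of lengths at most \<open>k\<^sub>1 \<le> k\<^sub>2\<close> exist only if \<open>2 \<le> k\<^sub>2\<close>.
\<close>

definition label_length :: "nat \<Rightarrow> int" where
  "label_length \<mu> = \<lfloor>log 2 (real \<mu>)\<rfloor> + 1"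

end

theory Submission
  imports Defs
begin

text \<open>
  Take a square of perimeter \<open>2D\<close> and let the obstacle be its whole interior, so that the
  terrain is the boundary curve. The agents start at opposite corners \<open>a\<close> and \<open>- a\<close> with opposite
  Norths: the instance is symmetric under \<open>z \<mapsto> - z\<close>, and the two agents perceive exactly
  the same, so that the route of an agent depends (up to sign) only on its label.

  Every step stays on one side of the square. Hence a route is coarsely described by the sequence
  of corners that it visits, without immediate repetitions. If \<open>v\<close> is the last visited corner,
  the agent is in the open half-plane \<open>z \<bullet> v > 0\<close>. The adversary lets both agents reach the
  \<open>j\<close>-th corner of their sequences at time \<open>j\<close>; as long as these sequences agree up to sign,
  the agents are separated by a line through the centre. So if the sequences of two labels agree in
  their first \<open>n\<close> entries, one of the agents traverses \<open>n\<close> sides before the meeting. As there are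
  four corners and \<open>2 ^ k\<^sub>1 - 1\<close> labels of length at most \<open>k\<^sub>1\<close>, such a pair exists for some
  \<open>n \<ge> k\<^sub>1 / 5\<close>.
\<close>

section \<open>The square as a terrain\<close>

text \<open>The sphere of radius \<open>h\<close> in the maximum norm: the boundary of the centred
  square with side \<open>2 * h\<close>.\<close>

definition ring :: "real \<Rightarrow> complex set" where
  "ring h = {z. max \<bar>Re z\<bar> \<bar>Im z\<bar> = h}"

definition corners :: "real \<Rightarrow> complex set" where
  "corners h = {z. \<bar>Re z\<bar> = h \<and> \<bar>Im z\<bar> = h}"

definition square :: "real \<Rightarrow> complex list" where
  "square h = [Complex (- h) (- h), Complex h (- h), Complex h h, Complex (- h) h]"

lemma mem_ring:
  "z \<in> ring h \<longleftrightarrow> (\<bar>Re z\<bar> = h \<and> \<bar>Im z\<bar> \<le> h) \<or> (\<bar>Im z\<bar> = h \<and> \<bar>Re z\<bar> \<le> h)"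
  by (auto simp: ring_def max_def)

lemma uminus_image_eqI:
  fixes S :: "'a::group_add set"
  assumes "\<And>z. z \<in> S \<Longrightarrow> - z \<in> S"
  shows "uminus ` S = S"
proof
  show "uminus ` S \<subseteq> S" using assms by blast
  show "S \<subseteq> uminus ` S"
  proof
    fix z assume "z \<in> S"
    then show "z \<in> uminus ` S" by (intro image_eqI[of z uminus "- z"] assms) simp_all
  qed
qed

lemma uminus_mem_iff:
  fixes S :: "'a::group_add set"
  assumes "uminus ` S = S"
  shows "- z \<in> S \<longleftrightarrow> z \<in> S"
  using assms by (metis image_eqI minus_minus)

lemma uminus_ring: "uminus ` ring h = ring h"
  by (rule uminus_image_eqI) (simp add: ring_def)

lemma closed_ring: "closed (ring h)"
  unfolding ring_def by (intro closed_Collect_eq continuous_intros)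

lemma norm_le_ring: "z \<in> ring h \<Longrightarrow> norm z \<le> 2 * h"
  using cmod_le[of z] by (simp add: ring_def max_def split: if_splits)

lemma corners_subset_ring: "corners h \<subseteq> ring h"
  by (auto simp: corners_def ring_def)

lemma corners_eq:
  assumes "0 < h"
  shows "corners h = set (square h)"
  using assms by (auto simp: corners_def square_def complex_eq_iff abs_if split: if_splits)

lemma dist_corners:
  assumes v: "v \<in> corners h" and w: "w \<in> corners h" and "v \<noteq> w"
  shows "2 * h \<le> dist v w"
proof -
  have *: "2 * h \<le> \<bar>x - y\<bar>" if "\<bar>x\<bar> = h" "\<bar>y\<bar> = h" "x \<noteq> y" for x y
    using that by linarith
  have "2 * h \<le> \<bar>Re (v - w)\<bar> \<or> 2 * h \<le> \<bar>Im (v - w)\<bar>"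
    using *[of "Re v" "Re w"] *[of "Im v" "Im w"] assms by (auto simp: corners_def complex_eq_iff)
  then show ?thesis
    using abs_Re_le_cmod[of "v - w"] abs_Im_le_cmod[of "v - w"] by (auto simp: dist_norm)
qed

text \<open>The midpoint has a coordinate of modulus \<open>h\<close>. An average of two numbers of
  modulus at most \<open>h\<close> has modulus \<open>h\<close> only if they coincide and have
  modulus \<open>h\<close> themselves.\<close>

lemma segment_in_side:
  assumes "closed_segment p q \<subseteq> ring h"
  shows "(\<bar>Re p\<bar> = h \<and> Re q = Re p) \<or> (\<bar>Im p\<bar> = h \<and> Im q = Im p)"
proof -
  have "p \<in> ring h" "q \<in> ring h" "midpoint p q \<in> ring h"
    using assms by (auto simp: subset_iff)
  then have "p \<in> ring h" "q \<in> ring h"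
    and mid: "\<bar>(Re p + Re q) / 2\<bar> = h \<or> \<bar>(Im p + Im q) / 2\<bar> = h"
    by (auto simp: mem_ring midpoint_def)
  have *: "\<bar>x\<bar> = h \<and> y = x" if "\<bar>(x + y) / 2\<bar> = h" "\<bar>x\<bar> \<le> h" "\<bar>y\<bar> \<le> h" for x y
  proof -
    have "\<bar>x + y\<bar> = 2 * h" using that(1) by simp
    then show ?thesis using that(2,3) by linarith
  qed
  have "\<bar>Re p\<bar> \<le> h" "\<bar>Im p\<bar> \<le> h" "\<bar>Re q\<bar> \<le> h" "\<bar>Im q\<bar> \<le> h"
    using \<open>p \<in> ring h\<close> \<open>q \<in> ring h\<close> by (auto simp: mem_ring)
  with mid * show ?thesis by blast
qed

text \<open>The open half-plane of a corner \<open>v\<close> can be left only at a corner. This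
  keeps the agents apart between two visits of corners.\<close>

lemma segment_leaves_at_corner:
  assumes seg: "closed_segment p q \<subseteq> ring h" and v: "v \<in> corners h" and pos: "0 < p \<bullet> v"
  shows "0 < q \<bullet> v \<or> (q \<in> corners h \<and> q \<bullet> v = 0)"
proof -
  have q: "q \<in> ring h" and p: "p \<in> ring h" using seg by auto
  \<comment> \<open>\<open>a\<close> is the coordinate fixed along the side, \<open>y\<close> and
    \<open>t\<close> are the other coordinates of \<open>p\<close> and \<open>q\<close>, and
    \<open>c\<close>, \<open>d\<close> are those of \<open>v\<close>. Positivity excludes
    \<open>a * c = - (h * h)\<close>; then \<open>t * d\<close> can cancel
    \<open>a * c = h * h\<close> only if \<open>t\<close> has modulus \<open>h\<close>.\<close>
  have key: "0 < a * c + t * d \<or> (\<bar>t\<bar> = h \<and> a * c + t * d = 0)"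
    if "\<bar>a\<bar> = h" "\<bar>c\<bar> = h" "\<bar>d\<bar> = h" "\<bar>y\<bar> \<le> h" "\<bar>t\<bar> \<le> h" "0 < a * c + y * d" for a c d y t :: real
  proof -
    have "\<bar>y * d\<bar> \<le> h * h" "\<bar>t * d\<bar> \<le> h * h" "\<bar>a * c\<bar> = h * h"
      using that by (simp_all add: abs_mult mult_right_mono)
    then have "a * c = h * h" "\<bar>t * d\<bar> \<le> h * h"
      using that by arith+
    then have "0 \<le> a * c + t * d" by arith
    moreover have "\<bar>t\<bar> = h" if "a * c + t * d = 0"
    proof -
      have "\<bar>t\<bar> * \<bar>d\<bar> = h * h" using that \<open>a * c = h * h\<close>
        by (metis abs_mult abs_minus_cancel abs_mult_self_eq add_eq_0_iff)
      then show ?thesis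
        using \<open>\<bar>d\<bar> = h\<close> \<open>\<bar>t\<bar> \<le> h\<close> by auto
    qed
    ultimately show ?thesis by linarith
  qed
  have vs: "\<bar>Re v\<bar> = h" "\<bar>Im v\<bar> = h" using v by (auto simp: corners_def)
  have le: "\<bar>Re p\<bar> \<le> h" "\<bar>Im p\<bar> \<le> h" "\<bar>Re q\<bar> \<le> h" "\<bar>Im q\<bar> \<le> h" using p q by (auto simp: mem_ring)
  from segment_in_side[OF seg] show ?thesis
  proof
    assume "\<bar>Re p\<bar> = h \<and> Re q = Re p"
    then show ?thesis
      using key[of "Re p" "Re v" "Im v" "Im p" "Im q"] vs le pos
      by (auto simp: corners_def inner_complex_def)
  next
    assume "\<bar>Im p\<bar> = h \<and> Im q = Im p"
    then show ?thesis
      using key[of "Im p" "Im v" "Re v" "Re p" "Re q"] vs le pos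
      by (auto simp: corners_def inner_complex_def add.commute)
  qed
qed

lemma uminus_mem_corners: "- v \<in> corners h \<longleftrightarrow> v \<in> corners h"
  by (simp add: corners_def)

section \<open>The square as a polygon: boundary, terrain and perimeter\<close>

lemma square_boundary:
  "polygon_boundary_path (square h) = rectpath (Complex (- h) (- h)) (Complex h h)"
  by (simp add: polygon_boundary_path_def square_def rectpath_def Let_def)

lemma is_polygon_square: "0 < h \<Longrightarrow> is_polygon (square h)"
  by (simp add: is_polygon_def square_boundary) (simp add: square_def)

lemma path_image_square:
  assumes "0 < h"
  shows "path_image (polygon_boundary_path (square h)) = ring h"
proof -
  have "x \<in> {- h, h} \<longleftrightarrow> \<bar>x\<bar> = h" "x \<in> {- h..h} \<longleftrightarrow> \<bar>x\<bar> \<le> h" for x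
    using assms by auto
  then show ?thesis
    using assms by (auto simp only: square_boundary path_image_rectpath mem_ring complex.sel Un_iff mem_Collect_eq)
qed

lemma terrain_set_square: "0 < h \<Longrightarrow> terrain_set (square h) {square h} = ring h"
  using inside_no_overlap[of "ring h"]
  by (simp add: terrain_set_def closed_polygon_def open_polygon_def path_image_square Un_Diff Diff_triv Int_commute)

text \<open>The outer polygon and the obstacle coincide, which is allowed because the obstacle is
  only removed as an open polygon.\<close>

lemma valid_terrain_square: "0 < h \<Longrightarrow> valid_terrain (square h) {square h}"
  by (simp add: valid_terrain_def is_polygon_square closed_polygon_def)

lemma perimeter_square:
  assumes "0 < h"
  shows "perimeter (square h) = 8 * h"
proof -
  have "dist (Complex x y) (Complex x' y) = \<bar>x - x'\<bar>" "dist (Complex x y) (Complex x y') = \<bar>y - y'\<bar>"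
    for x y x' y'
    by (simp_all add: dist_complex_def cmod_def)
  moreover have "{..<length (square h)} = {0, 1, 2, 3}"
    by (auto simp: square_def)
  ultimately show ?thesis
    using assms by (simp add: perimeter_def) (simp add: square_def)
qed

section \<open>Routes and the central symmetry\<close>

text \<open>Boundedness of \<open>T\<close> makes the supremum in \<open>advance\<close> one of a
  bounded set. The points strictly before it lie in \<open>S\<close>, and closedness of
  \<open>T\<close> adds the end.\<close>

lemma advance_segment:
  assumes S: "S \<subseteq> T" and T: "closed T" "bounded T" and p: "p \<in> T" and u: "norm u = 1"
  shows "closed_segment p (advance S p u d) \<subseteq> T"
proof -
  define R where "R = free_run S p u \<inter> (case d of None \<Rightarrow> UNIV | Some l \<Rightarrow> {..max 0 l})"
  define s where "s = Sup R"
  obtain B where B: "\<And>z. z \<in> T \<Longrightarrow> norm z \<le> B"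
    using T(2) by (auto simp: bounded_iff)
  \<comment> \<open>\<open>free_run\<close> does not constrain the point at distance
    \<open>r\<close> itself, so the bound is shown for \<open>c * r\<close> with
    \<open>c < 1\<close>.\<close>
  have "r \<le> 2 * B" if "r \<in> R" for r
  proof (rule field_le_mult_one_interval)
    fix c :: real assume c: "0 < c" "c < 1"
    show "c * r \<le> 2 * B"
    proof (cases "r = 0")
      case True
      then show ?thesis using order_trans[OF norm_ge_zero B[OF p]] by simp
    next
      case False
      then have "0 < r" using that by (simp add: R_def free_run_def)
      then have "p + of_real (c * r) * u \<in> T"
        using that c S by (auto simp: R_def free_run_def simp del: of_real_mult)
      then have "norm ((p + of_real (c * r) * u) - p) \<le> 2 * B"
        using B[OF p] B norm_triangle_ineq4 by (smt (verit, ccfv_SIG))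
      then show ?thesis
        using c \<open>0 < r\<close> u by (simp add: norm_mult)
    qed
  qed
  then have bdd: "bdd_above R" by (rule bdd_aboveI)
  have "0 \<in> R" by (auto simp: R_def free_run_def split: option.splits)
  then have s0: "0 \<le> s" unfolding s_def by (rule cSup_upper[OF _ bdd])
  have q: "advance S p u d = p + of_real s * u"
    by (simp add: advance_def s_def R_def)
  show ?thesis
  proof (cases "s = 0")
    case True
    then show ?thesis using p by (simp add: q)
  next
    case False
    have "open_segment p (p + of_real s * u) \<subseteq> T"
    proof
      fix z assume "z \<in> open_segment p (p + of_real s * u)"
      then obtain c where c: "0 < c" "c < 1" "z = (1 - c) *\<^sub>R p + c *\<^sub>R (p + of_real s * u)"
        by (auto simp: in_segment)
      then have z: "z = p + of_real (c * s) * u"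
        by (simp add: scaleR_conv_of_real algebra_simps)
      have "c * s < Sup R" using c s0 False by (simp add: s_def[symmetric])
      then obtain r where "r \<in> R" "c * s < r"
        using less_cSup_iff[OF _ bdd] \<open>0 \<in> R\<close> by blast
      then show "z \<in> T"
        using c(1,2) s0 False S unfolding z R_def free_run_def by (auto simp del: of_real_mult)
    qed
    then have "closure (open_segment p (p + of_real s * u)) \<subseteq> T"
      using T(1) by (rule closure_minimal)
    moreover have "u \<noteq> 0" using u by auto
    ultimately show ?thesis
      using False by (simp add: q)
  qed
qed

lemma step_segment:
  assumes "closed T" "bounded T" "p \<in> T" "norm n = 1"
  shows "closed_segment p (step T n p act) \<subseteq> T"
  using assms
  by (cases act)
    (simp_all add: advance_segment frontier_subset_closed interior_subset norm_mult)

lemma trace_not_Nil: "trace m A \<mu> T x n y k \<noteq> []"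
  by (induction k) (auto simp: Let_def split: option.splits)

lemma hd_trace: "hd (trace m A \<mu> T x n y k) = x"
  by (induction k) (auto simp: Let_def trace_not_Nil split: option.splits)

lemma trace_in_terrain:
  assumes "closed T" "bounded T" "x \<in> T" "norm n = 1"
  shows "successively (\<lambda>p q. closed_segment p q \<subseteq> T) (trace m A \<mu> T x n y k)
           \<and> last (trace m A \<mu> T x n y k) \<in> T"
proof (induction k)
  case 0
  then show ?case using assms by simp
next
  case (Suc k)
  let ?ps = "trace m A \<mu> T x n y k"
  show ?case
  proof (cases "decision m A \<mu> T x n y ?ps")
    case None
    then show ?thesis using Suc by simp
  next
    case (Some act)
    have "closed_segment (last ?ps) (step T n (last ?ps) act) \<subseteq> T"
      using assms Suc by (intro step_segment) auto
    then show ?thesis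
      using Some Suc by (auto simp: Let_def successively_append_iff)
  qed
qed

lemma trace_stable:
  assumes "decision m A \<mu> T x n y (trace m A \<mu> T x n y k) = None" "k \<le> k'"
  shows "trace m A \<mu> T x n y k' = trace m A \<mu> T x n y k"
  using assms(2) by (induction k' rule: dec_induct) (simp_all add: assms(1))

text \<open>The shorter of the two traces has already ended. This identifies the routes supplied by
  \<open>rendezvous_algorithm\<close> with given ones.\<close>

lemma is_route_unique:
  assumes "is_route m A \<mu> T x n y ps" "is_route m A \<mu> T x n y qs"
  shows "ps = qs"
proof -
  obtain k k' where k: "ps = trace m A \<mu> T x n y k" "qs = trace m A \<mu> T x n y k'"
    using assms by (auto simp: is_route_def)
  show ?thesis
  proof (cases "k \<le> k'")
    case True
    then show ?thesis
      using trace_stable[of m A \<mu> T x n y k k'] assms(1) by (simp add: is_route_def k)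
  next
    case False
    then show ?thesis
      using trace_stable[of m A \<mu> T x n y k' k] assms(2) by (simp add: is_route_def k)
  qed
qed

section \<open>Steps, percepts and decisions under the point reflection\<close>

lemma advance_uminus:
  assumes "uminus ` S = S"
  shows "advance S (- p) (- u) d = - advance S p u d"
proof -
  have "free_run S (- p) (- u) = free_run S p u"
    using uminus_mem_iff[OF assms, of "p + of_real r * u" for r] by (simp add: free_run_def)
  then show ?thesis by (simp add: advance_def)
qed

text \<open>Reflection turns a segment from \<open>p\<close> in direction \<open>u\<close> into one
  from \<open>- p\<close> in direction \<open>- u\<close>, and \<open>slopes\<close> admits both
  orientations.\<close>

lemma slopes_uminus:
  assumes "uminus ` S = S"
  shows "slopes S (- p) = slopes S p"
proof -
  have "closed_segment (- p) (- q) \<subseteq> S \<longleftrightarrow> closed_segment p q \<subseteq> S" for q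
  proof -
    have "closed_segment (- p) (- q) = uminus ` closed_segment p q"
      by (rule closed_segment_linear_image[OF linear_uminus])
    then show ?thesis by (simp only: image_subset_iff uminus_mem_iff[OF assms]) blast
  qed
  from this[of "p + of_real e * u" for e u] this[of "p - of_real e * u" for e u]
  show ?thesis unfolding slopes_def by (auto simp: algebra_simps)
qed

lemma uminus_slopes: "uminus ` slopes S p = slopes S p"
  by (rule uminus_image_eqI) (auto simp: slopes_def)

text \<open>A half-turn of start, North and point together is invisible in private
  coordinates.\<close>

lemma chart_uminus: "chart (- x) (- n) (- p) = chart x n p"
  by (simp add: chart_def minus_divide_left diff_divide_distrib)

context
  fixes T :: "complex set"
  assumes symmetric: "uminus ` T = T"
begin

lemma uminus_interior: "uminus ` interior T = interior T"
  using interior_negations[of T] by (simp add: symmetric)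

lemma uminus_frontier: "uminus ` frontier T = frontier T"
proof -
  have "uminus ` closure T = closure T"
    using closure_injective_linear_image[of uminus T] by (simp add: symmetric linear_uminus)
  then show ?thesis
    unfolding frontier_def by (simp add: image_set_diff uminus_interior)
qed

lemma step_uminus: "step T (- n) (- p) act = - step T n p act"
  using advance_uminus[OF uminus_interior] advance_uminus[OF uminus_frontier]
  by (cases act) simp_all

lemma observe_uminus: "observe T (- x) (- n) (- p) = observe T x n p"
proof -
  \<comment> \<open>Reversing the North negates every perceived direction, which changes nothing
    because slopes are unoriented.\<close>
  have "uminus ` slopes (frontier T) p = slopes (frontier T) p"
    by (rule uminus_slopes)
  moreover have "(\<lambda>u. u / - n) ` X = (\<lambda>u. u / n) ` uminus ` X" for X
    by (simp add: image_image)
  ultimately have "(\<lambda>u. u / - n) ` slopes (frontier T) p = (\<lambda>u. u / n) ` slopes (frontier T) p"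
    by simp
  then show ?thesis
    using uminus_mem_iff[OF uminus_frontier, of p] slopes_uminus[OF uminus_frontier, of p]
    by (simp add: observe_def chart_uminus)
qed

lemma decision_uminus:
  "decision m A \<mu> T (- x) (- n) (- y) (map uminus ps) = decision m A \<mu> T x n y ps"
proof -
  have "chart (- x) (- n) ` T = chart (- x) (- n) ` uminus ` T"
    by (simp add: symmetric)
  also have "\<dots> = chart x n ` T"
    by (simp add: image_image chart_uminus)
  finally show ?thesis
    by (simp add: decision_def agent_map_def observe_uminus chart_uminus comp_def)
qed

text \<open>Equal maps and percepts give equal actions, and the same action under the opposite North
  ends at the reflected point.\<close>

lemma trace_uminus:
  "trace m A \<mu> T (- x) (- n) (- y) k = map uminus (trace m A \<mu> T x n y k)"
  by (induction k)
    (auto simp: Let_def decision_uminus step_uminus last_map trace_not_Nil split: option.splits)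

lemma is_route_uminus:
  assumes "is_route m A \<mu> T x n y ps"
  shows "is_route m A \<mu> T (- x) (- n) (- y) (map uminus ps)"
  using assms by (auto simp: is_route_def trace_uminus decision_uminus)

end

section \<open>Walks synchronized by corners\<close>

definition path_length :: "complex list \<Rightarrow> real" where
  "path_length ps = (\<Sum>i<length ps - 1. dist (ps ! i) (ps ! Suc i))"

lemma path_length_singleton: "path_length [p] = 0"
  by (simp add: path_length_def)

lemma path_length_snoc:
  assumes "ps \<noteq> []"
  shows "path_length (ps @ [p]) = path_length ps + dist (last ps) p"
proof -
  obtain n where n: "length ps = Suc n" using assms by (cases ps) auto
  then show ?thesis
    using assms by (simp add: path_length_def nth_append last_conv_nth)
qed

lemma is_walk_mono:
  assumes "is_walk ps \<tau> f" "i < j" "j < length ps"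
  shows "\<tau> i < \<tau> j"
  using assms(2,3)
proof (induction j)
  case (Suc j)
  have "\<tau> j < \<tau> (Suc j)" using assms(1) Suc.prems by (simp add: is_walk_def)
  then show ?case using Suc by (cases "i = j") auto
qed simp

text \<open>The segments before point \<open>i\<close> are completed by time \<open>t\<close> and
  count in full; the others contribute nonnegative terms.\<close>

lemma path_length_le_trajectory_length:
  assumes "is_walk ps \<tau> f" "i < length ps" "\<tau> i \<le> t"
  shows "path_length (take (Suc i) ps) \<le> trajectory_length ps \<tau> f t"
proof -
  have "\<tau> (Suc k) \<le> t" if "k < i" for k
  proof (cases "Suc k = i")
    case False
    then have "\<tau> (Suc k) < \<tau> i" using that assms by (intro is_walk_mono) auto
    then show ?thesis using assms(3) by simp
  qed (use assms in auto)
  then have "path_length (take (Suc i) ps) =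
      (\<Sum>k<i. if \<tau> (Suc k) \<le> t then dist (ps ! k) (ps ! Suc k)
             else if \<tau> k \<le> t then dist (ps ! k) (f t) else 0)"
    using assms(2) by (auto simp: path_length_def intro!: sum.cong)
  also have "\<dots> \<le> trajectory_length ps \<tau> f t"
    unfolding trajectory_length_def using assms(2) by (intro sum_mono2) auto
  finally show ?thesis .
qed

lemma trajectory_length_nonneg: "0 \<le> trajectory_length ps \<tau> f t"
  unfolding trajectory_length_def by (intro sum_nonneg) auto

text \<open>Inspecting the ends of steps suffices: a segment in \<open>ring h\<close> lies on one
  side and has no corner strictly between its ends. Consecutive markers are distinct, hence at least
  \<open>2 * h\<close> apart.\<close>

definition markers :: "real \<Rightarrow> complex list \<Rightarrow> complex list" where
  "markers h ps = remdups_adj (filter (\<lambda>p. p \<in> corners h) ps)"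

lemma markers_not_Nil: "ps \<noteq> [] \<Longrightarrow> hd ps \<in> corners h \<Longrightarrow> markers h ps \<noteq> []"
  by (cases ps) (auto simp: markers_def)

lemma set_markers: "set (markers h ps) \<subseteq> corners h"
  by (auto simp: markers_def)

lemma markers_snoc:
  assumes "ps \<noteq> []" "hd ps \<in> corners h"
  shows "markers h (ps @ [p]) =
    (if p \<in> corners h \<and> p \<noteq> last (markers h ps) then markers h ps @ [p] else markers h ps)"
proof -
  have "filter (\<lambda>p. p \<in> corners h) ps \<noteq> []"
    using assms by (cases ps) auto
  then obtain qs q where "filter (\<lambda>p. p \<in> corners h) ps = qs @ [q]"
    by (metis rev_exhaust)
  then show ?thesis
    by (auto simp: markers_def remdups_adj_append_two)
qed

lemma markers_uminus: "markers h (map uminus ps) = map uminus (markers h ps)"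
proof -
  have "markers h (map uminus ps) = remdups_adj (map uminus (filter (\<lambda>p. p \<in> corners h) ps))"
    by (simp add: markers_def filter_map comp_def uminus_mem_corners)
  then show ?thesis
    by (simp add: markers_def remdups_adj_map_injective)
qed

text \<open>The distance from the last marker to the current point strengthens the induction: it
  grows by at most the length of the new step, and at a new marker it is traded for
  \<open>2 * h\<close>.\<close>

lemma markers_le_path_length:
  assumes "ps \<noteq> []" "hd ps \<in> corners h"
  shows "real (length (markers h ps) - 1) * (2 * h) + dist (last (markers h ps)) (last ps)
           \<le> path_length ps"
  using assms
proof (induction ps rule: rev_induct)
  case (snoc p ps)
  show ?case
  proof (cases "ps = []")
    case True
    then show ?thesis using snoc by (simp add: markers_def path_length_def)
  next
    case False
    then have hd: "hd ps \<in> corners h" using snoc by simp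
    let ?L = "markers h ps"
    have L: "?L \<noteq> []" using False hd by (rule markers_not_Nil)
    then have last: "last ?L \<in> corners h" using set_markers last_in_set by blast
    have IH: "real (length ?L - 1) * (2 * h) + dist (last ?L) (last ps) \<le> path_length ps"
      using snoc False hd by simp
    have tri: "dist (last ?L) p \<le> dist (last ?L) (last ps) + dist (last ps) p"
      by (rule dist_triangle)
    show ?thesis
    proof (cases "p \<in> corners h \<and> p \<noteq> last ?L")
      case True
      then have "2 * h \<le> dist (last ?L) p"
        using dist_corners[OF last, of p] by auto
      moreover have "real (length ?L) * (2 * h) = real (length ?L - 1) * (2 * h) + 2 * h"
        using L by (cases ?L) (auto simp: distrib_right)
      ultimately have "real (length ?L) * (2 * h) \<le> path_length ps + dist (last ps) p"
        using IH tri by linarith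
      then show ?thesis
        using True False hd by (simp add: path_length_snoc markers_snoc)
    next
      case nochange: False
      then show ?thesis
        using IH tri False hd by (auto simp: path_length_snoc markers_snoc)
    qed
  qed
qed simp

lemma inner_corner_self: "0 < h \<Longrightarrow> v \<in> corners h \<Longrightarrow> 0 < v \<bullet> v"
  by (auto simp: corners_def)

lemma linepath_inner_pos:
  assumes "0 < q \<bullet> v" "0 \<le> p \<bullet> v" "0 \<le> u" "u \<le> 1" "u = 1 \<Longrightarrow> 0 < p \<bullet> v"
  shows "0 < linepath q p u \<bullet> v"
proof (cases "u = 1")
  case True
  then show ?thesis using assms by (simp add: linepath_def)
next
  case False
  then have "0 < (1 - u) * (q \<bullet> v) + u * (p \<bullet> v)"
    using assms by (intro add_pos_nonneg) auto
  then show ?thesis by (simp add: linepath_def inner_add_left)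
qed

text \<open>The new segment is traversed at constant speed from time \<open>r\<close> to time
  \<open>s\<close>, and \<open>min 1\<close> lets the agent rest afterwards. Continuity on all of
  \<open>{0..}\<close> will make the set of meeting times closed.\<close>

lemma is_walk_snoc:
  fixes p :: complex and s :: real
  assumes walk: "is_walk ps \<tau> f" and ps: "ps \<noteq> []" and s: "\<tau> (length ps - 1) < s"
  defines "r \<equiv> \<tau> (length ps - 1)"
  defines "g \<equiv> \<lambda>t. if t \<le> r then f t else linepath (last ps) p (min 1 ((t - r) / (s - r)))"
  shows "is_walk (ps @ [p]) (\<tau>(length ps := s)) g"
    and "continuous_on {0..} f \<Longrightarrow> continuous_on {0..} g"
proof -
  let ?l = "\<lambda>t. linepath (last ps) p (min 1 ((t - r) / (s - r)))"
  have fr: "f r = last ps" using walk by (simp add: is_walk_def r_def)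
  have rs: "r < s" using s by (simp add: r_def)
  have cl: "continuous_on A ?l" for A
    unfolding linepath_def by (intro continuous_intros) (use rs in auto)
  have g_eq: "g t = ?l t" if "r \<le> t" for t
    using that fr by (cases "t = r") (auto simp: g_def linepath_def)
  have mono: "\<tau> i \<le> r" if "i < length ps" for i
  proof (cases "i = length ps - 1")
    case False
    then have "\<tau> i < r"
      unfolding r_def using that by (intro is_walk_mono[OF walk]) auto
    then show ?thesis by simp
  qed (simp add: r_def)
  have lseg: "?l t \<in> closed_segment (last ps) p" if "r \<le> t" for t
    unfolding linepath_image_01[symmetric] using that rs by (intro imageI) (auto simp: min_def)
  have piece: "(\<tau>(length ps := s)) i < (\<tau>(length ps := s)) (Suc i) \<and>
        continuous_on {(\<tau>(length ps := s)) i..(\<tau>(length ps := s)) (Suc i)} g \<and>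
        g ` {(\<tau>(length ps := s)) i..(\<tau>(length ps := s)) (Suc i)}
          \<subseteq> closed_segment ((ps @ [p]) ! i) ((ps @ [p]) ! Suc i) \<and>
        g ((\<tau>(length ps := s)) i) = (ps @ [p]) ! i \<and>
        g ((\<tau>(length ps := s)) (Suc i)) = (ps @ [p]) ! Suc i"
    if i: "Suc i < length (ps @ [p])" for i
  proof (cases "Suc i = length ps")
    case True
    then have ri: "\<tau> i = r" "ps ! i = last ps" 
      using ps by (auto simp: r_def last_conv_nth simp flip: True)
    have "continuous_on {r..s} g"
      using cl by (rule continuous_on_eq) (simp add: g_eq)
    moreover have "g ` {r..s} \<subseteq> closed_segment (last ps) p"
      using lseg g_eq by auto
    moreover have "g r = last ps" "g s = p"
      using rs by (auto simp: g_eq linepath_def)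
    ultimately show ?thesis
      using True ri rs by (simp add: nth_append flip: True)
  next
    case False
    then have i: "Suc i < length ps" using i by simp
    then have "g t = f t" if "t \<le> \<tau> (Suc i)" for t
      using mono[OF i] that by (simp add: g_def)
    moreover have "\<tau> i < \<tau> (Suc i)" "continuous_on {\<tau> i..\<tau> (Suc i)} f"
        "f ` {\<tau> i..\<tau> (Suc i)} \<subseteq> closed_segment (ps ! i) (ps ! Suc i)"
        "f (\<tau> i) = ps ! i" "f (\<tau> (Suc i)) = ps ! Suc i"
      using walk i by (auto simp: is_walk_def)
    moreover from calculation have "continuous_on {\<tau> i..\<tau> (Suc i)} g"
      by (auto intro: continuous_on_eq)
    ultimately show ?thesis
      using i by (simp add: nth_append)
  qed
  have "g t = p" if "s \<le> t" for t
  proof -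
    have "min 1 ((t - r) / (s - r)) = 1" using that rs by (simp add: min_def)
    then show ?thesis using that rs by (simp add: g_eq linepath_def)
  qed
  then show "is_walk (ps @ [p]) (\<tau>(length ps := s)) g"
    unfolding is_walk_def using piece ps walk by (auto simp: is_walk_def)
  assume cf: "continuous_on {0..} f"
  have "0 \<le> r"
    using mono[of 0] ps walk by (simp add: is_walk_def)
  then have "{0..} = {0..r} \<union> {r..}" by auto
  moreover have "continuous_on {0..r} g"
    by (rule continuous_on_eq[of _ f]) (auto intro: continuous_on_subset[OF cf] simp: g_def)
  moreover have "continuous_on {r..} g"
    using cl by (rule continuous_on_eq) (simp add: g_eq)
  ultimately show "continuous_on {0..} g"
    by (simp only:) (rule continuous_on_closed_Un; simp)
qed

text \<open>
  The walk reaches its \<open>j\<close>-th marker exactly at time \<open>j\<close>. Steps that do not reach a new marker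
  halve the time left until the next integer.
\<close>

lemma phased_walk:
  assumes "ps \<noteq> []" "hd ps \<in> corners h" "0 < h"
    and "successively (\<lambda>p q. closed_segment p q \<subseteq> ring h) ps"
  shows "\<exists>\<tau> f. is_walk ps \<tau> f \<and> continuous_on {0..} f \<and>
    real (length (markers h ps) - 1) \<le> \<tau> (length ps - 1) \<and>
    \<tau> (length ps - 1) < real (length (markers h ps)) \<and>
    (\<forall>t\<ge>0. 0 < f t \<bullet> (markers h ps ! min (nat \<lfloor>t\<rfloor>) (length (markers h ps) - 1))) \<and>
    (\<forall>j<length (markers h ps). \<exists>i<length ps.
       \<tau> i \<le> real j \<and> real j * (2 * h) \<le> path_length (take (Suc i) ps))"
  using assms
proof (induction ps rule: rev_induct)
  case (snoc p ps)
  show ?case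
  proof (cases "ps = []")
    case True
    then have "markers h (ps @ [p]) = [p]" using snoc by (simp add: markers_def)
    moreover have "is_walk [p] (\<lambda>_. 0) (\<lambda>_. p)" by (simp add: is_walk_def)
    ultimately show ?thesis
      using True snoc.prems inner_corner_self[of h p]
      by (intro exI[of _ "\<lambda>_. 0"] exI[of _ "\<lambda>_. p"]) (simp add: path_length_singleton)
  next
    case False
    then have hd: "hd ps \<in> corners h"
      and succ: "successively (\<lambda>p q. closed_segment p q \<subseteq> ring h) ps"
      and seg: "closed_segment (last ps) p \<subseteq> ring h"
      using snoc.prems by (auto simp: successively_append_iff)
    define L where "L = markers h ps"
    define N where "N = length L - 1"
    define v where "v = last L"
    have "L \<noteq> []" unfolding L_def using False hd by (rule markers_not_Nil)
    then have lenL: "length L = Suc N" and v: "v = L ! N"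
      by (cases L; simp add: N_def v_def last_conv_nth)+
    have vc: "v \<in> corners h"
      using \<open>L \<noteq> []\<close> set_markers[of h ps] last_in_set[of L] by (auto simp: v_def L_def)
    obtain \<tau> f where walk: "is_walk ps \<tau> f" and cont: "continuous_on {0..} f"
      and r: "real N \<le> \<tau> (length ps - 1)" "\<tau> (length ps - 1) < real (Suc N)"
      and pos: "\<And>t. 0 \<le> t \<Longrightarrow> 0 < f t \<bullet> (L ! min (nat \<lfloor>t\<rfloor>) N)"
      and emit: "\<And>j. j \<le> N \<Longrightarrow> \<exists>i<length ps.
         \<tau> i \<le> real j \<and> real j * (2 * h) \<le> path_length (take (Suc i) ps)"
      using snoc.IH[OF False hd \<open>0 < h\<close> succ] lenL
      unfolding L_def[symmetric] by (auto simp: less_Suc_eq_le)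
    define r where "r = \<tau> (length ps - 1)"
    define new where "new \<longleftrightarrow> p \<in> corners h \<and> p \<noteq> v"
    define s where "s = (if new then real (Suc N) else (r + real (Suc N)) / 2)"
    define \<tau>' where "\<tau>' = \<tau>(length ps := s)"
    define g where "g = (\<lambda>t. if t \<le> r then f t
      else linepath (last ps) p (min 1 ((t - r) / (s - r))))"
    have rs: "r < s" "s \<le> real (Suc N)" and rN: "real N \<le> r"
      using r by (auto simp: s_def r_def field_simps)
    have L': "markers h (ps @ [p]) = (if new then L @ [p] else L)"
      using markers_snoc[OF False hd] by (simp add: L_def v_def new_def)
    have walk': "is_walk (ps @ [p]) \<tau>' g"
      unfolding \<tau>'_def g_def r_def by (rule is_walk_snoc(1)[OF walk False rs(1)[unfolded r_def]])
    have cont': "continuous_on {0..} g"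
      unfolding g_def r_def by (rule is_walk_snoc(2)[OF walk False rs(1)[unfolded r_def] cont])
    have fr: "f r = last ps" using walk by (simp add: is_walk_def r_def)
    have floor: "N \<le> nat \<lfloor>t\<rfloor>" if "real N \<le> t" for t
      using that by (simp add: le_nat_floor)
    have last_pos: "0 < last ps \<bullet> v"
      using pos[of r] rN floor[of r] by (simp add: fr v min_absorb2)
    have p: "0 < p \<bullet> v \<or> (p \<in> corners h \<and> p \<bullet> v = 0)"
      using segment_leaves_at_corner[OF seg vc last_pos] .
    \<comment> \<open>If \<open>p\<close> is not new, either it is no corner and the first
      alternative holds, or \<open>p = v\<close>.\<close>
    have p_pos: "0 < p \<bullet> v" if "\<not> new"
      using that p inner_corner_self[OF \<open>0 < h\<close> vc] by (auto simp: new_def)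
    \<comment> \<open>Only the arrival at a new marker, \<open>u = 1\<close>, may lie on the line
      orthogonal to \<open>v\<close>.\<close>
    have line_pos: "0 < linepath (last ps) p u \<bullet> v" if "0 \<le> u" "u \<le> 1" "\<not> new \<or> u < 1" for u
      using that p p_pos by (intro linepath_inner_pos[OF last_pos]) auto
    have pos': "0 < g t \<bullet> (markers h (ps @ [p]) ! min (nat \<lfloor>t\<rfloor>) (length (markers h (ps @ [p])) - 1))"
      if "0 \<le> t" for t
    proof (cases "t \<le> r")
      case True
      then have "t < real (Suc N)" using rs by simp
      then have "nat \<lfloor>t\<rfloor> \<le> N" using that by linarith
      then show ?thesis
        using pos[OF that] True lenL by (simp add: g_def L' nth_append min_def)
    next
      case t: False
      have u: "0 \<le> min 1 ((t - r) / (s - r))" "min 1 ((t - r) / (s - r)) \<le> 1"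
        using rs t by auto
      have ft: "N \<le> nat \<lfloor>t\<rfloor>" using t rN by (intro floor) simp
      show ?thesis
      \<comment> \<open>With a new marker, the index switches from \<open>v\<close> to
        \<open>p\<close> exactly at time \<open>s = Suc N\<close>. Without one, \<open>min\<close>
        keeps it at \<open>N\<close>.\<close>
      proof (cases "new \<and> s \<le> t")
        case True
        then have "real (Suc N) \<le> t" by (auto simp: s_def)
        then have "Suc N \<le> nat \<lfloor>t\<rfloor>" by (rule le_nat_floor)
        moreover have "min 1 ((t - r) / (s - r)) = 1" using True rs by (simp add: min_def)
        ultimately show ?thesis
          using True t lenL inner_corner_self[OF \<open>0 < h\<close>, of p]
          by (simp add: g_def L' nth_append new_def linepath_def)
      next
        case False
        then have "\<not> new \<or> min 1 ((t - r) / (s - r)) < 1"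
          using rs by (auto simp: min_less_iff_disj)
        then have "0 < g t \<bullet> v"
          using line_pos[OF u] t by (simp add: g_def)
        moreover have "nat \<lfloor>t\<rfloor> = N" if new
        proof -
          have "t < real (Suc N)" using that False by (simp add: s_def)
          then show ?thesis using ft \<open>0 \<le> t\<close> by linarith
        qed
        ultimately show ?thesis
          using ft lenL by (auto simp: L' nth_append v min_def)
      qed
    qed
    have emit': "\<exists>i<length (ps @ [p]). \<tau>' i \<le> real j \<and>
        real j * (2 * h) \<le> path_length (take (Suc i) (ps @ [p]))"
      if j: "j < length (markers h (ps @ [p]))" for j
    proof (cases "j \<le> N")
      case True
      then obtain i where "i < length ps" "\<tau> i \<le> real j"
          "real j * (2 * h) \<le> path_length (take (Suc i) ps)"
        using emit by blast
      then show ?thesis by (intro exI[of _ i]) (simp add: \<tau>'_def)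
    next
      case False
      then have "new" "j = Suc N" using j lenL by (auto simp: L' split: if_splits)
      moreover have "real (length (markers h (ps @ [p])) - 1) * (2 * h) \<le> path_length (ps @ [p])"
        using markers_le_path_length[of "ps @ [p]" h] snoc.prems(2)
          zero_le_dist[of "last (markers h (ps @ [p]))" "last (ps @ [p])"]
        by (simp del: zero_le_dist)
      ultimately show ?thesis
        using lenL by (intro exI[of _ "length ps"]) (simp add: \<tau>'_def s_def L')
    qed
    have "real (length (markers h (ps @ [p])) - 1) \<le> \<tau>' (length (ps @ [p]) - 1)"
      "\<tau>' (length (ps @ [p]) - 1) < real (length (markers h (ps @ [p])))"
      using r lenL by (auto simp: L' \<tau>'_def s_def r_def)
    with walk' cont' pos' emit' show ?thesis by blast
  qed
qed simp

section \<open>Distance along the square\<close>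

text \<open>The Lipschitz bound makes the sum telescope, uniformly in the partition, as needed to
  bound \<open>curve_length\<close>.\<close>

lemma sum_increments_le:
  assumes "sorted xs" "set xs \<subseteq> {0..1::real}" "0 \<le> C"
    and "\<And>s t. 0 \<le> s \<Longrightarrow> s \<le> t \<Longrightarrow> t \<le> 1 \<Longrightarrow> dist (g s) (g t) \<le> C * (t - s)"
  shows "(\<Sum>i<length xs - 1. dist (g (xs ! i)) (g (xs ! Suc i))) \<le> C"
proof -
  let ?n = "length xs - 1"
  have mem: "xs ! i \<in> {0..1}" if "i < length xs" for i
    using assms(2) that nth_mem by blast
  have "(\<Sum>i<?n. dist (g (xs ! i)) (g (xs ! Suc i))) \<le> (\<Sum>i<?n. C * (xs ! Suc i - xs ! i))"
    using mem assms(1) by (intro sum_mono assms(4)) (auto simp: sorted_iff_nth_mono)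
  also have "\<dots> = C * (xs ! ?n - xs ! 0)"
    by (simp add: sum_distrib_left[symmetric] sum_lessThan_telescope)
  also have "\<dots> \<le> C"
  proof (cases "xs = []")
    case False
    then have "xs ! ?n - xs ! 0 \<le> 1"
      using mem[of ?n] mem[of 0] by auto
    then show ?thesis using assms(3) mult_left_mono[of "xs ! ?n - xs ! 0" 1 C] by simp
  qed (use assms(3) in simp)
  finally show ?thesis .
qed

lemma terrain_dist_ring:
  assumes h: "0 < h"
  shows "terrain_dist (ring h) (Complex (- h) (- h)) (Complex h h) = ereal (4 * h)"
    (is "terrain_dist _ ?a ?b = _")
proof (rule antisym)
  \<comment> \<open>The bottom side is traversed until \<open>t = 1/2\<close>, then the right side,
    at speed \<open>4 * h\<close>.\<close>
  define g where "g t = Complex (min h (4 * h * t - h)) (max (- h) (4 * h * t - 3 * h))" for t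
  have "path g"
    unfolding path_def g_def by (intro continuous_intros)
  moreover have "path_image g \<subseteq> ring h"
  proof -
    have "g t \<in> ring h" if "0 \<le> t" "t \<le> 1" for t
    proof -
      have "0 \<le> h * t" "h * t \<le> h" using h that by simp_all
      then show ?thesis
        by (auto simp: g_def mem_ring min_def max_def abs_le_iff abs_if)
    qed
    then show ?thesis by (auto simp: path_image_def)
  qed
  moreover have "pathstart g = ?a" "pathfinish g = ?b"
    using h by (auto simp: pathstart_def pathfinish_def g_def)
  moreover have "dist (g s) (g t) \<le> 4 * h * (t - s)" if "s \<le> t" for s t
  proof -
    have "h * s \<le> h * t" using h that by simp
    then have "\<bar>Re (g s - g t)\<bar> + \<bar>Im (g s - g t)\<bar> \<le> 4 * h * (t - s)"
      by (auto simp: g_def min_def max_def algebra_simps)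
    then show ?thesis
      using cmod_le[of "g s - g t"] by (simp add: dist_norm)
  qed
  then have "curve_length g \<le> ereal (4 * h)"
    unfolding curve_length_def using h
    by (intro SUP_least) (simp only: ereal_less_eq mem_Collect_eq, intro sum_increments_le, auto)
  ultimately show "terrain_dist (ring h) ?a ?b \<le> ereal (4 * h)"
    unfolding terrain_dist_def by (intro INF_lower2[of g]) auto
next
  show "ereal (4 * h) \<le> terrain_dist (ring h) ?a ?b"
    unfolding terrain_dist_def
  proof (rule INF_greatest)
    fix g assume "g \<in> {g. path g \<and> path_image g \<subseteq> ring h \<and> pathstart g = ?a \<and> pathfinish g = ?b}"
    then have g: "continuous_on {0..1} g" "g ` {0..1} \<subseteq> ring h" "g 0 = ?a" "g 1 = ?b"
      by (auto simp: path_def path_image_def pathstart_def pathfinish_def)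
    \<comment> \<open>The antidiagonal separates the end points and meets the ring only in the other
      two corners, each at distance \<open>2 * h\<close> from both ends.\<close>
    have "\<exists>t\<ge>0. t \<le> 1 \<and> Re (g t) + Im (g t) = 0"
      using g h by (intro IVT') (auto intro: continuous_intros)
    then obtain t where t: "0 \<le> t" "t \<le> 1" "Re (g t) + Im (g t) = 0" by blast
    then have "g t \<in> ring h" using g by auto
    then have "g t = Complex h (- h) \<or> g t = Complex (- h) h"
      using t(3) by (auto simp: mem_ring complex_eq_iff abs_if split: if_splits)
    then have "dist ?a (g t) + dist (g t) ?b = 4 * h"
      using h by (auto simp: dist_complex_def cmod_def real_sqrt_mult)
    moreover have "(\<Sum>i<length [0, t, 1] - 1. dist (g ([0, t, 1] ! i)) (g ([0, t, 1] ! Suc i)))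
        = dist ?a (g t) + dist (g t) ?b"
      by (simp add: g lessThan_Suc)
    ultimately show "ereal (4 * h) \<le> curve_length g"
      unfolding curve_length_def using t by (intro SUP_upper2[of "[0, t, 1]"]) auto
  qed
qed

section \<open>Cost of rendezvous\<close>

text \<open>If one list is shorter than \<open>n\<close>, the lists are equal; otherwise the cap is
  inactive. The cap models an agent that reaches no further marker.\<close>

lemma nth_min_eq_if_take_eq:
  assumes "take n xs = take n ys" "k < n"
  shows "xs ! min k (length xs - 1) = ys ! min k (length ys - 1)"
proof -
  have "min (length xs) n = min (length ys) n"
    using arg_cong[OF assms(1), of length] by simp
  then consider "length xs < n" "length ys = length xs" | "n \<le> length xs" "n \<le> length ys"
    by arith
  then show ?thesis
  proof cases
    case 1
    then show ?thesis using assms(1) by (metis less_imp_le take_all)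
  next
    case 2
    then have "min k (length xs - 1) = k" "min k (length ys - 1) = k" using assms(2) by auto
    then show ?thesis using assms by (metis nth_take)
  qed
qed

text \<open>\<open>qs\<close> is the route that label \<open>l2\<close> would take from
  \<open>a\<close> with North \<open>1\<close>; its reflection is the actual route from
  \<open>- a\<close> with North \<open>- 1\<close>. Under phased walks the current markers are
  opposite until time \<open>n\<close>, which excludes an earlier meeting.\<close>

lemma rendezvous_cost_ring:
  assumes h: "0 < h" and A: "rendezvous_algorithm m A"
    and labels: "0 < l1" "0 < l2" "l1 \<noteq> l2"
    and a: "a \<in> corners h"
    and ps: "is_route m A l1 (ring h) a 1 (- a) ps"
    and qs: "is_route m A l2 (ring h) a 1 (- a) qs"
    and eq: "take n (markers h ps) = take n (markers h qs)"
  shows "ereal (real n * (2 * h)) \<le> rendezvous_cost m A l1 l2 (ring h) a (- a)"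
proof -
  let ?T = "ring h" and ?L1 = "markers h ps" and ?L2 = "markers h qs"
  have T: "closed ?T" "bounded ?T" "is_terrain ?T"
    using closed_ring norm_le_ring valid_terrain_square[OF h] terrain_set_square[OF h, symmetric]
    unfolding bounded_iff is_terrain_def by blast+
  have a': "- a \<in> corners h" using a by (simp add: uminus_mem_corners)
  have aT: "a \<in> ?T" "- a \<in> ?T" using a a' corners_subset_ring by auto
  have "a \<noteq> - a" using a h by (auto simp: corners_def complex_eq_iff)
  have qs': "is_route m A l2 ?T (- a) (- 1) a (map uminus qs)"
    using is_route_uminus[OF uminus_ring qs] by simp
  have "\<exists>ps' qs'. is_route m A l1 ?T a 1 (- a) ps' \<and> is_route m A l2 ?T (- a) (- 1) a qs' \<and>
     (\<forall>\<tau> f \<sigma> g. is_walk ps' \<tau> f \<and> is_walk qs' \<sigma> g \<longrightarrow> (\<exists>t\<ge>0. f t = g t))"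
    using A T(3) aT \<open>a \<noteq> - a\<close> labels unfolding rendezvous_algorithm_def by simp
  then have meet: "\<exists>t\<ge>0. f t = g t" if "is_walk ps \<tau> f" "is_walk (map uminus qs) \<sigma> g" for \<tau> f \<sigma> g
    using is_route_unique[OF ps] is_route_unique[OF qs'] that by metis
  have route: "rs \<noteq> [] \<and> hd rs \<in> corners h \<and> successively (\<lambda>p q. closed_segment p q \<subseteq> ?T) rs"
    if "is_route m A l ?T x n y rs" "x \<in> corners h" "norm n = 1" for l x n y rs
    using that trace_not_Nil hd_trace trace_in_terrain[OF T(1,2), of x n]
      corners_subset_ring[of h] by (auto simp: is_route_def)
  obtain \<tau> f where f: "is_walk ps \<tau> f" "continuous_on {0..} f"
    and fpos: "\<And>t. 0 \<le> t \<Longrightarrow> 0 < f t \<bullet> (?L1 ! min (nat \<lfloor>t\<rfloor>) (length ?L1 - 1))"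
    and femit: "\<And>j. j < length ?L1 \<Longrightarrow> \<exists>i<length ps.
       \<tau> i \<le> real j \<and> real j * (2 * h) \<le> path_length (take (Suc i) ps)"
    using phased_walk[of ps h] route[OF ps a] h by auto
  obtain \<sigma> g where g: "is_walk (map uminus qs) \<sigma> g" "continuous_on {0..} g"
    and gpos: "\<And>t. 0 \<le> t \<Longrightarrow> 0 < g t \<bullet> (map uminus ?L2 ! min (nat \<lfloor>t\<rfloor>) (length ?L2 - 1))"
    and gemit: "\<And>j. j < length ?L2 \<Longrightarrow> \<exists>i<length (map uminus qs).
       \<sigma> i \<le> real j \<and> real j * (2 * h) \<le> path_length (take (Suc i) (map uminus qs))"
    using phased_walk[of "map uminus qs" h] route[OF qs' a'] h
    unfolding markers_uminus length_map by auto
  have L2: "?L2 \<noteq> []"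
    using route[OF qs a] by (intro markers_not_Nil) auto
  \<comment> \<open>A common point cannot have positive inner product with both \<open>v\<close> and
    \<open>- v\<close>.\<close>
  have apart: "?L1 ! min (nat \<lfloor>t\<rfloor>) (length ?L1 - 1) \<noteq> ?L2 ! min (nat \<lfloor>t\<rfloor>) (length ?L2 - 1)"
    if "0 \<le> t" "f t = g t" for t
  proof -
    have "min (nat \<lfloor>t\<rfloor>) (length ?L2 - 1) < length ?L2" using L2 by (simp add: min_less_iff_disj)
    then show ?thesis using fpos[of t] gpos[of t] that by auto
  qed
  \<comment> \<open>The set of meeting times is closed, so its infimum is the first meeting.\<close>
  define M where "M = {t \<in> {0..}. f t - g t = 0}"
  have "closed M"
    unfolding M_def using f(2) g(2)
    by (intro continuous_closed_preimage_constant continuous_intros) auto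
  moreover have "M \<noteq> {}" using meet[OF f(1) g(1)] by (auto simp: M_def)
  moreover have "bdd_below M" by (auto simp: M_def intro: bdd_belowI)
  ultimately have "Inf M \<in> M" by (metis closed_contains_Inf)
  define t where "t = Inf M"
  have t: "0 \<le> t" "f t = g t" using \<open>Inf M \<in> M\<close> by (auto simp: M_def t_def)
  have "f s \<noteq> g s" if "0 \<le> s" "s < t" for s
  proof
    assume "f s = g s"
    then have "t \<le> s" unfolding t_def using \<open>bdd_below M\<close> that by (intro cInf_lower) (auto simp: M_def)
    then show False using that by simp
  qed
  then have time: "rendezvous_time f g t" using t by (simp add: rendezvous_time_def)
  have "real n \<le> t"
  proof (rule ccontr)
    assume "\<not> real n \<le> t"
    then have "nat \<lfloor>t\<rfloor> < n" using t(1) by linarith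
    then show False using nth_min_eq_if_take_eq[OF eq] apart[OF t] by blast
  qed
  \<comment> \<open>If both sequences had length at most \<open>n\<close>, the equal prefixes would
    be the whole sequences. So one of them has an entry with index \<open>n\<close>, reached by time
    \<open>n\<close> after a length of at least \<open>n\<close> sides.\<close>
  have "?L1 \<noteq> ?L2" using apart[OF t] by auto
  then consider "n < length ?L1" | "n < length ?L2" using eq by fastforce
  then have "real n * (2 * h) \<le> trajectory_length ps \<tau> f t + trajectory_length (map uminus qs) \<sigma> g t"
  proof cases
    case 1
    then obtain i where "i < length ps" "\<tau> i \<le> real n"
        "real n * (2 * h) \<le> path_length (take (Suc i) ps)"
      using femit by blast
    then show ?thesis
      using path_length_le_trajectory_length[OF f(1), of i t] \<open>real n \<le> t\<close>
        trajectory_length_nonneg[of "map uminus qs" \<sigma> g t] by simp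
  next
    case 2
    then obtain i where "i < length (map uminus qs)" "\<sigma> i \<le> real n"
        "real n * (2 * h) \<le> path_length (take (Suc i) (map uminus qs))"
      using gemit by blast
    then show ?thesis
      using path_length_le_trajectory_length[OF g(1), of i t] \<open>real n \<le> t\<close>
        trajectory_length_nonneg[of ps \<tau> f t] by simp
  qed
  moreover have "ereal (trajectory_length ps \<tau> f t + trajectory_length (map uminus qs) \<sigma> g t)
      \<le> rendezvous_cost m A l1 l2 ?T a (- a)"
    unfolding rendezvous_cost_def
    using ps qs' f(1) g(1) time by (intro Sup_upper) (force intro: exI[of _ 1] exI[of _ "- 1"])
  ultimately show ?thesis
    by (metis ereal_less_eq(3) order_trans)
qed

section \<open>Counting labels against corner sequences\<close>

lemma label_length_le:
  assumes "0 < \<mu>" "\<mu> < 2 ^ k"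
  shows "label_length \<mu> \<le> int k"
proof -
  have "real \<mu> < 2 ^ k" using assms(2) by (metis of_nat_less_iff of_nat_numeral of_nat_power)
  then have "log 2 (real \<mu>) < real k"
    using assms(1) by (simp add: log_less_iff powr_realpow)
  then have "\<lfloor>log 2 (real \<mu>)\<rfloor> < int k" by (simp add: floor_less_iff)
  then show ?thesis by (simp add: label_length_def)
qed

text \<open>Pigeonhole: there are fewer than \<open>4 ^ (n + 1) / 3\<close> lists of length at most
  \<open>n\<close> over four corners. Shorter lists are counted too, since a route may visit fewer
  than \<open>n\<close> corners.\<close>

lemma labels_with_common_prefix:
  fixes L :: "nat \<Rightarrow> 'a list" and k1 k2 :: int
  assumes V: "finite V" "card V \<le> 4" and L: "\<And>l. 0 < l \<Longrightarrow> set (L l) \<subseteq> V"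
    and start: "\<And>l. 0 < l \<Longrightarrow> take 1 (L l) = [a]"
    and k: "0 < k1" "k1 \<le> k2" "2 \<le> k2"
  shows "\<exists>l1 l2 n. 0 < l1 \<and> 0 < l2 \<and> l1 \<noteq> l2 \<and> label_length l1 \<le> k1 \<and> label_length l2 \<le> k2 \<and>
    take n (L l1) = take n (L l2) \<and> k1 \<le> 5 * int n"
proof (cases "k1 \<le> 5")
  \<comment> \<open>Here \<open>n = 1\<close> suffices by \<open>start\<close>. For
    \<open>k1 = 1\<close> only label \<open>1\<close> is short enough for \<open>k1\<close>, so
    label \<open>2\<close> relies on \<open>2 \<le> k2\<close>.\<close>
  case True
  have "label_length 1 \<le> k1" "label_length 2 \<le> k2"
    using label_length_le[of 1 1] label_length_le[of 2 2] k by simp_all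
  moreover have "take 1 (L 1) = take 1 (L 2)" using start[of 1] start[of 2] by simp
  ultimately show ?thesis
    using True by (intro exI[of _ 1] exI[of _ 2]) simp
next
  case False
  \<comment> \<open>The largest \<open>n\<close> with
    \<open>4 ^ (n + 1) \<le> 2 ^ k\<close>.\<close>
  define k n where "k = nat k1" and "n = k div 2 - 1"
  have kn: "2 * (n + 1) \<le> k" "k1 \<le> 5 * int n" "2 \<le> k"
    using False by (auto simp: k_def n_def)
  define C where "C = {xs. set xs \<subseteq> V \<and> length xs \<le> n}"
  let ?labels = "{1..<(2::nat) ^ k}"
  have "finite C" unfolding C_def using V(1) by (rule finite_lists_length_le)
  have "card C = (\<Sum>i\<le>n. card V ^ i)"
    unfolding C_def using V(1) by (rule card_lists_length_le)
  also have "\<dots> \<le> (\<Sum>i\<le>n. 4 ^ i)"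
    using V(2) by (intro sum_mono power_mono) auto
  finally have "3 * card C \<le> 3 * (\<Sum>i\<le>n. (4::nat) ^ i)" by simp
  also have "3 * (\<Sum>i\<le>n. (4::nat) ^ i) < 4 ^ (n + 1)"
    by (induction n) auto
  also have "(4::nat) ^ (n + 1) = 2 ^ (2 * (n + 1))"
    by (simp add: power_mult)
  also have "\<dots> \<le> 2 ^ k"
    using kn(1) by (intro power_increasing) auto
  \<comment> \<open>The factor \<open>3\<close> leaves room for the exclusion of label
    \<open>0\<close>: only \<open>2 ^ k - 1\<close> labels are available.\<close>
  finally have "3 * card C < 2 ^ k" .
  moreover have "(2::nat) ^ 2 \<le> 2 ^ k" using kn(3) by (intro power_increasing) auto
  ultimately have "card C < card ?labels" by simp
  moreover have "take n (L l) \<in> C" if "l \<in> ?labels" for l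
    using L[of l] set_take_subset[of n "L l"] that by (auto simp: C_def)
  then have "(\<lambda>l. take n (L l)) ` ?labels \<subseteq> C" by blast
  ultimately have "card ((\<lambda>l. take n (L l)) ` ?labels) < card ?labels"
    using card_mono[OF \<open>finite C\<close>] by (meson le_less_trans)
  then obtain l1 l2 where l: "l1 \<in> ?labels" "l2 \<in> ?labels" "l1 \<noteq> l2"
    and eq: "take n (L l1) = take n (L l2)"
    using pigeonhole unfolding inj_on_def by blast
  have "label_length l \<le> k1" if "l \<in> ?labels" for l
    using label_length_le[of l k] that False by (simp add: k_def)
  then have "0 < l1" "0 < l2" "label_length l1 \<le> k1" "label_length l2 \<le> k2"
    using l k(2) by (auto intro: order_trans)
  then show ?thesis using l(3) eq kn(2) by blast
qed

theorem theorem2p4: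
  shows "\<exists>c::real. 0 < c \<and>
    (\<forall>(m::bool) (A::algorithm) (D::real) (k1::int) (k2::int).
       rendezvous_algorithm m A \<and> 0 < D \<and> 0 < k1 \<and> k1 \<le> k2 \<and> 2 \<le> k2 \<longrightarrow>
       (\<exists>l1 l2 P Q a b.
          0 < l1 \<and> 0 < l2 \<and> l1 \<noteq> l2 \<and> label_length l1 \<le> k1 \<and> label_length l2 \<le> k2 \<and>
          valid_terrain P {Q} \<and> perimeter Q = 2 * D \<and>
          a \<in> terrain_set P {Q} \<and> b \<in> terrain_set P {Q} \<and>
          terrain_dist (terrain_set P {Q}) a b = ereal D \<and>
          ereal (c * D * real_of_int k1) \<le> rendezvous_cost m A l1 l2 (terrain_set P {Q}) a b))"
\<comment> \<open>The sides have length \<open>D / 2\<close> and \<open>n \<ge> k1 / 5\<close>, so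
  \<open>n\<close> sides have total length at least \<open>D * k1 / 10\<close>.\<close>
proof (intro exI[of _ "1 / 10"] conjI allI impI)
  fix m :: bool and A :: algorithm and D :: real and k1 k2 :: int
  assume "rendezvous_algorithm m A \<and> 0 < D \<and> 0 < k1 \<and> k1 \<le> k2 \<and> 2 \<le> k2"
  then have A: "rendezvous_algorithm m A" and D: "0 < D" and k: "0 < k1" "k1 \<le> k2" "2 \<le> k2"
    by auto
  \<comment> \<open>The perimeter is \<open>8 * h = 2 * D\<close>, and opposite corners are
    \<open>4 * h = D\<close> apart in the terrain.\<close>
  define h a where "h = D / 4" and "a = Complex (- h) (- h)"
  have h: "0 < h" using D by (simp add: h_def)
  have b: "- a = Complex h h" by (simp add: a_def complex_eq_iff)
  have a: "a \<in> corners h" "- a \<in> corners h" using h by (auto simp: a_def corners_def)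
  have T: "terrain_set (square h) {square h} = ring h" using h by (rule terrain_set_square)
  have ab: "a \<in> ring h" "- a \<in> ring h" "a \<noteq> - a"
    using a corners_subset_ring h by (auto simp: a_def complex_eq_iff)
  have terrain: "is_terrain (ring h)"
    using valid_terrain_square[OF h] T by (auto simp: is_terrain_def)
  have "\<exists>ps. is_route m A l (ring h) a 1 (- a) ps" if "0 < l" for l
  proof -
    \<comment> \<open>Routes are supplied only for pairs of distinct labels; \<open>Suc l\<close> is
      an arbitrary partner, on whose label the route of \<open>l\<close> does not depend.\<close>
    have "\<exists>ps qs. is_route m A l (ring h) a 1 (- a) ps \<and> is_route m A (Suc l) (ring h) (- a) 1 a qs \<and>
       (\<forall>\<tau> f \<sigma> g. is_walk ps \<tau> f \<and> is_walk qs \<sigma> g \<longrightarrow> (\<exists>t\<ge>0. f t = g t))"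
      using A terrain ab that unfolding rendezvous_algorithm_def by simp
    then show ?thesis by blast
  qed
  then obtain R where R: "\<And>l. 0 < l \<Longrightarrow> is_route m A l (ring h) a 1 (- a) (R l)" by metis
  have "take 1 (markers h (R l)) = [a]" if l: "0 < l" for l
  proof -
    obtain qs where "R l = a # qs"
      using R[OF l] hd_trace trace_not_Nil
      by (metis is_route_def list.collapse)
    then have "markers h (R l) \<noteq> []" "hd (markers h (R l)) = a" using a by (auto simp: markers_def)
    then show ?thesis by (cases "markers h (R l)") auto
  qed
  moreover have "finite (corners h)" "card (corners h) \<le> 4"
    unfolding corners_eq[OF h] using card_length[of "square h"] by (simp_all add: square_def)
  ultimately obtain l1 l2 n where l: "0 < l1" "0 < l2" "l1 \<noteq> l2" "label_length l1 \<le> k1" "label_length l2 \<le> k2"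
    and n: "take n (markers h (R l1)) = take n (markers h (R l2))" "k1 \<le> 5 * int n"
    using labels_with_common_prefix[of "corners h" "\<lambda>l. markers h (R l)" a k1 k2] set_markers k by blast
  have "ereal (real n * (2 * h)) \<le> rendezvous_cost m A l1 l2 (ring h) a (- a)"
    using rendezvous_cost_ring[OF h A l(1-3) a(1) R[OF l(1)] R[OF l(2)] n(1)] .
  moreover have "1 / 10 * D * real_of_int k1 \<le> real n * (2 * h)"
  proof -
    have "real_of_int k1 \<le> 5 * real n" using n(2) by linarith
    then have "D * real_of_int k1 \<le> D * (5 * real n)" using D by (intro mult_left_mono) auto
    then show ?thesis by (simp add: h_def algebra_simps)
  qed
  ultimately have "ereal (1 / 10 * D * real_of_int k1) \<le> rendezvous_cost m A l1 l2 (ring h) a (- a)"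
    by (metis ereal_less_eq(3) order_trans)
  moreover have "terrain_dist (ring h) a (- a) = ereal D"
    unfolding b unfolding a_def using terrain_dist_ring[OF h] by (simp add: h_def)
  moreover have "perimeter (square h) = 2 * D" using perimeter_square[OF h] by (simp add: h_def)
  ultimately show "\<exists>l1 l2 P Q a b.
          0 < l1 \<and> 0 < l2 \<and> l1 \<noteq> l2 \<and> label_length l1 \<le> k1 \<and> label_length l2 \<le> k2 \<and>
          valid_terrain P {Q} \<and> perimeter Q = 2 * D \<and>
          a \<in> terrain_set P {Q} \<and> b \<in> terrain_set P {Q} \<and>
          terrain_dist (terrain_set P {Q}) a b = ereal D \<and>
          ereal (1 / 10 * D * real_of_int k1) \<le> rendezvous_cost m A l1 l2 (terrain_set P {Q}) a b"
    using l ab valid_terrain_square[OF h]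
    by (intro exI[of _ l1] exI[of _ l2] exI[of _ "square h"] exI[of _ a] exI[of _ "- a"]) (simp add: T)
qed simp

end
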